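(* Let $\sigma$ be the Kleinian $\sigma$-function of an $(N,s)$-curve $C$ of genus $g$. For all integers $m\ge 2$, $n\ge 1$ and all indices $i_1\le\dots\le i_n$ in $\{1,\dots,g\}$, the $n$-index $m$th order $\mathcal{R}$-function $$\mathcal{R}^{[m]}_{i_1,\dots,i_n}=\left(-\frac{1}{m\sigma^m}\right)\Bigl(S\circ\mathcal{H}^{[m]}_{i_1}\circ\cdots\circ\mathcal{H}^{[m]}_{i_n}\bigotimes_{k=1}^m\sigma\Bigr)$$ is Abelian, i.e. it is a standard Abelian function associated with $C$.
   Context: Curve. Let $2\le N<s$ be coprime integers. An $(N,s)$-curve $C$ is the plane algebraic curve $f(x,y)=0$ with $f(x,y)=y^N+q_1(x)y^{N-1}+\dots+q_{N-1}(x)y-q_N(x)$, where each $q_j$ is a polynomial of degree at most $\lfloor js/N\rfloor$, $q_N$ is monic of degree $s$, and $C$ is non-singular; $C$ also denotes the compact Riemann surface it defines, which has a single point $\infty$ at infinity and genus $g=\frac12(N-1)(s-1)\ge 1$. (The integer $N$ has nothing to do with the number $n$ of indices.) Periods. Let $du_1,\dots,du_g$ be the standard basis $h_i\,dx/f_y$ ($h_i$ monomials in $x,y$) of holomorphic differentials on $C$, and $\bm{du}=(du_1,\dots,du_g)$. Let $\alpha_1,\dots,\alpha_g,\beta_1,\dots,\beta_g$ be a symplectic basis of $H_1(C,\mathbb{Z})$ ($\alpha_i\cdot\alpha_j=\beta_i\cdot\beta_j=0$, $\alpha_i\cdot\beta_j=\delta_{ij}$). Let $dr_1,\dots,dr_g$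 be the associated basis of differentials of the second kind, with only pole at $\infty$. Let $\omega',\omega'',\eta',\eta''$ be the $g\times g$ matrices with $(k,\ell)$ entries $\oint_{\alpha_\ell}du_k$, $\oint_{\beta_\ell}du_k$, $\oint_{\alpha_\ell}dr_k$, $\oint_{\beta_\ell}dr_k$, the $dr_k$ being normalised so that the generalised Legendre relation holds: $\eta'(\omega')^{-1}$ is symmetric and $\eta''=\eta'(\omega')^{-1}\omega''-2\pi i((\omega')^{-1})^T$. Let $\Lambda=\{\omega'\bm m+\omega''\bm n:\bm m,\bm n\in\mathbb{Z}^g\}\subset\mathbb{C}^g$, $J=\mathbb{C}^g/\Lambda$, $\kappa:\mathbb{C}^g\to J$ the quotient map. Let $W^{[k]}\subset J$ be the set of points $\int_\infty^{P_1}\bm{du}+\dots+\int_\infty^{P_k}\bm{du}$ mod $\Lambda$ with $P_i\in C$, and $\Theta^{[k]}=W^{[k]}\cup(-W^{[k]})$. $\sigma$-function. Let $\bm\delta=\omega'\bm\delta'+\omega''\bm\delta''$ ($\bm\delta',\bm\delta''\in\mathbb{R}^g$) be the Riemann constant with base point $\infty$. Put $\tau=(\omega')^{-1}\omega''$, $z=(\omega')^{-1}\bm u$ and $$\sigma(\bm u)=c\,\exp\bigl(\tfrac12\bm u^T\eta'(\omega')^{-1}\bm u\bigr)\sum_{\bm m\in\mathbb{Z}^g}\exp\Bigl[2\pi i\bigl\{\tfrac12(\bm m+\bm\delta'')^T\tau(\bm m+\bm\delta'')+(\bm m+\bm\delta'')^T(z+\bm\delta')\bigr\}\Bigr],$$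 with $c\ne0$ a constant. Recalled known facts: $\sigma$ is entire on $\mathbb{C}^g$; it vanishes exactly along $\kappa^{-1}(\Theta^{[g-1]})$, with order one; and for $\bm\ell=\omega'\bm\ell'+\omega''\bm\ell''\in\Lambda$ ($\bm\ell',\bm\ell''\in\mathbb{Z}^g$), $\sigma(\bm u+\bm\ell)=\chi(\bm\ell)\,e^{L(\bm u)}\sigma(\bm u)$, where $L(\bm u)=(\bm u+\frac{\bm\ell}{2})^T(\eta'\bm\ell'+\eta''\bm\ell'')$ and $\chi(\bm\ell)=\exp[2\pi i\{(\bm\ell')^T\bm\delta''-(\bm\ell'')^T\bm\delta'+\frac12(\bm\ell')^T\bm\ell''\}]$. Abelian functions. A meromorphic function $\mathfrak{M}$ on $\mathbb{C}^g$ is a standard Abelian function associated with $C$ if its poles lie only along $\kappa^{-1}(\Theta^{[g-1]})$ and $\mathfrak{M}(\bm u+\bm\ell)=\mathfrak{M}(\bm u)$ for all $\bm\ell\in\Lambda$. Operators. Let $F$ be the $\mathbb{C}$-algebra of entire functions of $\bm u=(u_1,\dots,u_g)$; tensor products are over $\mathbb{C}$. For $m\ge2$ let $\zeta=\exp(2\pi i/m)$ and let $\partial_i^{[j]}$ be the linear operator on $F^{\otimes m}$ that differentiates the $j$th tensor entry with respect to $u_i$. The $m$th order generalised Baker--Hirota operator is $\mathcal{H}_i^{[m]}=\sum_{j=1}^m\zeta^{j-1}\partial_i^{[j]}$. The symmetrization operator $S:F^{\otimes m}\to F$ is the linear map $S(f^{[1]}\otimes\dots\otimes f^{[m]})=\prod_{k=1}^m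 f^{[k]}$. *)

theory Defs
  imports "HOL-Complex_Analysis.Complex_Analysis" "HOL-Homology.Homology"
begin

section \<open>Holomorphic, meromorphic and entire functions of several complex variables\<close>

definition holomorphic_several :: "(complex^'g \<Rightarrow> complex) \<Rightarrow> (complex^'g) set \<Rightarrow> bool" where
  "holomorphic_several F U \<longleftrightarrow>
     (\<forall>u\<in>U. \<exists>D. (F has_derivative D) (at u) \<and> (\<forall>a h. D (a *s h) = a * D h))"

definition partial_deriv :: "'g::finite \<Rightarrow> (complex^'g \<Rightarrow> complex) \<Rightarrow> complex^'g \<Rightarrow> complex" where
  "partial_deriv i F u = deriv (\<lambda>t. F (u + axis i t)) 0"

lemma bounded_linear_vscale: "bounded_linear (\<lambda>t::complex. t *s (v::complex^'g))"
  by (intro linear_conv_bounded_linear[THEN iffD1] linearI) (auto simp: vec_eq_iff algebra_simps)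

lemma slice_DERIV:
  fixes F :: "complex^'g \<Rightarrow> complex"
  assumes D: "(F has_derivative D) (at (u + t *s v))" and lin: "\<And>a h. D (a *s h) = a * D h"
  shows "((\<lambda>t. F (u + t *s v)) has_field_derivative D v) (at t)"
proof -
  have "((\<lambda>t. u + t *s v) has_derivative (\<lambda>h. h *s v)) (at t)"
    using bounded_linear.has_derivative[OF bounded_linear_vscale has_derivative_ident]
    by (auto intro!: derivative_eq_intros)
  from has_derivative_compose[OF this D]
  have "((\<lambda>t. F (u + t *s v)) has_derivative (\<lambda>h. D (h *s v))) (at t)" by simp
  then show ?thesis
    by (simp add: has_field_derivative_def lin mult.commute[of _ "D v"] fun_eq_iff)
qed

lemma axis_vscale: "axis i t = (t::complex) *s axis i 1"
  by (auto simp: vec_eq_iff axis_def)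

lemma directional_Cauchy:
  fixes F :: "complex^'g \<Rightarrow> complex"
  assumes D: "\<And>u. (F has_derivative D u) (at u)" and lin: "\<And>u a h. D u (a *s h) = a * D u h"
  shows "D u v = integral (cbox 0 1) (\<lambda>x::real. F (u + exp (2 * of_real pi * \<i> * of_real x) *s v) / exp (2 * of_real pi * \<i> * of_real x))"
proof -
  let ?f = "\<lambda>t. F (u + t *s v)"
  have cp: "circlepath 0 1 x = exp (2 * of_real pi * \<i> * of_real x)" for x
    by (simp add: circlepath)
  have vd: "vector_derivative (circlepath 0 1) (at x) = 2 * of_real pi * \<i> * exp (2 * of_real pi * \<i> * of_real x)" for x
    using vector_derivative_circlepath[of 0 1 x] by simp
  have der: "(?f has_field_derivative D (u + t *s v) v) (at t)" for t
    by (rule slice_DERIV[OF D lin])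
  then have hol: "?f holomorphic_on S" for S
    by (meson field_differentiable_at_within field_differentiable_def holomorphic_on_def)
  have "(?f has_field_derivative (1 / (2 * of_real pi * \<i>) * contour_integral (circlepath 0 1) (\<lambda>w. ?f w / (w - 0)^2))) (at 0)"
    by (rule Cauchy_derivative_integral_circlepath(2)) (auto intro: hol holomorphic_on_imp_continuous_on)
  with der[of 0] have "D u v = 1 / (2 * of_real pi * \<i>) * contour_integral (circlepath 0 1) (\<lambda>w. ?f w / w^2)"
    using DERIV_unique by fastforce
  also have "contour_integral (circlepath 0 1) (\<lambda>w. ?f w / w^2) =
     integral {0..1} (\<lambda>x. 2 * of_real pi * \<i> * (?f (exp (2 * of_real pi * \<i> * of_real x)) / exp (2 * of_real pi * \<i> * of_real x)))"
    unfolding contour_integral_integral vd cp by (intro integral_cong) (simp add: power2_eq_square)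
  also have "\<dots> = 2 * of_real pi * \<i> *
     integral {0..1} (\<lambda>x. ?f (exp (2 * of_real pi * \<i> * of_real x)) / exp (2 * of_real pi * \<i> * of_real x))"
    by (rule integral_mult_right)
  finally show ?thesis by simp
qed

lemma holomorphic_several_partial_deriv:
  fixes F :: "complex^'g \<Rightarrow> complex"
  assumes "holomorphic_several F UNIV"
  shows "holomorphic_several (partial_deriv i F) UNIV"
proof -
  from assms obtain D where D: "\<And>u. (F has_derivative D u) (at u)"
    and lin: "\<And>u a h. D u (a *s h) = a * D u h"
    unfolding holomorphic_several_def by (metis UNIV_I)
  define v :: "complex^'g" where "v = axis i 1"
  have ax: "axis i t = t *s v" for t unfolding v_def by (rule axis_vscale)
  define E where "E x = exp (2 * of_real pi * \<i> * of_real x)" for x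
  have E0: "E x \<noteq> 0" for x by (simp add: E_def)
  have contF: "continuous_on UNIV F"
    by (meson D continuous_at_imp_continuous_on has_derivative_continuous)
  have contE: "continuous_on S E" for S unfolding E_def by (intro continuous_intros)
  have contvs: "continuous_on S (\<lambda>p. f p *s w)" if "continuous_on S f"
    for S :: "'b::topological_space set" and f and w :: "complex^'g"
    by (rule bounded_linear.continuous_on[OF bounded_linear_vscale that])
  have contE2: "continuous_on S (\<lambda>p. E (snd p))" for S :: "((complex^'g) \<times> real) set"
    by (rule continuous_on_compose2[OF contE[of UNIV] continuous_on_snd[OF continuous_on_id]]) simp
  have contarg: "continuous_on S (\<lambda>p. fst p + E (snd p) *s w)" for S and w :: "complex^'g"
    by (intro continuous_on_add continuous_on_fst continuous_on_id contvs contE2)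
  have contq: "continuous_on S (\<lambda>p. G (fst p + E (snd p) *s w) / E (snd p))"
    if "continuous_on UNIV G" for S and w :: "complex^'g" and G :: "complex^'g \<Rightarrow> complex"
    by (intro continuous_on_divide contE2 continuous_on_compose2[OF that contarg]) (auto simp: E0)
  have key: "D u w = integral (cbox 0 1) (\<lambda>x. F (u + E x *s w) / E x)" for u w
    using directional_Cauchy[of F D u w] D lin by (simp add: E_def)
  have pd: "partial_deriv i F u = D u v" for u
  proof -
    have "((\<lambda>t. F (u + t *s v)) has_field_derivative D u v) (at 0)"
      by (rule slice_DERIV) (use D[of u] lin in auto)
    then show ?thesis
      unfolding partial_deriv_def ax by (rule DERIV_imp_deriv)
  qed
  have contD: "continuous_on UNIV (\<lambda>u. D u w)" for w
    unfolding key[of _ w]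
  proof (rule integral_continuous_on_param)
    show "continuous_on (UNIV \<times> cbox 0 1) (\<lambda>(u, x). F (u + E x *s w) / E x)"
      using contq[OF contF, of "UNIV \<times> cbox 0 1" w] by (simp only: case_prod_unfold)
  qed
  define fx where "fx u x = Blinfun (\<lambda>h. D (u + E x *s v) h / E x)" for u x
  have bl: "bounded_linear (\<lambda>h. D u h / E x)" for u x
    by (intro bounded_linear_divide[THEN bounded_linear_compose] has_derivative_bounded_linear[OF D])
  have fx: "blinfun_apply (fx u x) = (\<lambda>h. D (u + E x *s v) h / E x)" for u x
    unfolding fx_def by (rule bounded_linear_Blinfun_apply[OF bl])
  have contfx: "continuous_on (UNIV \<times> cbox 0 1) (\<lambda>(u, x). fx u x)"
  proof (rule continuous_on_blinfun_componentwise)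
    fix b :: "complex^'g"
    show "continuous_on (UNIV \<times> cbox 0 1) (\<lambda>p. (case p of (u, x) \<Rightarrow> fx u x) b)"
      using contq[OF contD[of b], of "UNIV \<times> cbox 0 1" v] by (simp only: split_beta fx)
  qed
  have der: "((\<lambda>u. integral (cbox 0 1) (\<lambda>x. F (u + E x *s v) / E x)) has_derivative
       blinfun_apply (integral (cbox 0 1) (fx u))) (at u within UNIV)" for u
  proof (rule leibniz_rule[OF _ _ contfx])
    fix y :: "complex^'g" and x :: real
    have "((\<lambda>u. u + E x *s v) has_derivative (\<lambda>h. h)) (at y)"
      by (auto intro!: derivative_eq_intros)
    from has_derivative_compose[OF this D]
    have "((\<lambda>u. F (u + E x *s v)) has_derivative D (y + E x *s v)) (at y)" by simp
    from bounded_linear.has_derivative[OF bounded_linear_divide this, of "E x"]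
    show "((\<lambda>u. F (u + E x *s v) / E x) has_derivative blinfun_apply (fx y x)) (at y within UNIV)"
      by (simp add: fx)
  next
    fix y :: "complex^'g"
    have "continuous_on (cbox 0 1) (\<lambda>x. y + E x *s v)"
      by (intro continuous_on_add continuous_on_const contvs contE)
    from continuous_on_compose2[OF contF this]
    show "(\<lambda>x. F (y + E x *s v) / E x) integrable_on cbox 0 1"
      by (intro integrable_continuous continuous_on_divide contE) (auto simp: E0)
  qed auto
  have int: "(fx u) integrable_on cbox 0 1" for u
  proof (rule integrable_continuous)
    have pr: "continuous_on (cbox 0 1) (\<lambda>x. (u, x))"
      by (intro continuous_intros)
    show "continuous_on (cbox 0 1) (fx u)"
      using continuous_on_compose2[OF contfx pr] by (simp add: image_subset_iff del: box_real)
  qed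
  have app: "blinfun_apply (integral (cbox 0 1) (fx u)) h = integral (cbox 0 1) (\<lambda>x. D (u + E x *s v) h / E x)" for u h
    using integral_linear[OF int[of u], of "\<lambda>b. blinfun_apply b h"]
    by (simp add: o_def fx blinfun.bounded_linear_left)
  show ?thesis
    unfolding holomorphic_several_def
  proof (intro ballI exI conjI allI)
    fix u :: "complex^'g"
    show "(partial_deriv i F has_derivative blinfun_apply (integral (cbox 0 1) (fx u))) (at u)"
      using der[of u] unfolding pd[abs_def] key by simp
    fix a h
    show "blinfun_apply (integral (cbox 0 1) (fx u)) (a *s h) = a * blinfun_apply (integral (cbox 0 1) (fx u)) h"
      unfolding app lin by (simp add: times_divide_eq_right[symmetric] del: times_divide_eq_right)
  qed
qed

text \<open>Locally a quotient of holomorphic functions; the values of \<^term>\<open>M\<close> at zeros of the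
  local denominators are irrelevant.\<close>

definition meromorphic_several :: "(complex^'g \<Rightarrow> complex) \<Rightarrow> bool" where
  "meromorphic_several M \<longleftrightarrow>
     (\<forall>p. \<exists>U A B. open U \<and> connected U \<and> p \<in> U \<and>
        holomorphic_several A U \<and> holomorphic_several B U \<and> (\<exists>u\<in>U. B u \<noteq> 0) \<and>
        (\<forall>u\<in>U. B u \<noteq> 0 \<longrightarrow> M u = A u / B u))"

definition poles_only_along :: "(complex^'g \<Rightarrow> complex) \<Rightarrow> (complex^'g) set \<Rightarrow> bool" where
  "poles_only_along M D \<longleftrightarrow> (\<forall>p. p \<notin> D \<longrightarrow> (\<exists>U. open U \<and> p \<in> U \<and> holomorphic_several M U))"

text \<open>The divisor of an entire function is reduced (all multiplicities are one) iff the points of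
  its zero set at which the gradient does not vanish are dense in the zero set.\<close>

definition vanishes_exactly_to_order_one :: "(complex^'g \<Rightarrow> complex) \<Rightarrow> (complex^'g) set \<Rightarrow> bool" where
  "vanishes_exactly_to_order_one F D \<longleftrightarrow>
     {u. F u = 0} = D \<and> D \<subseteq> closure {u\<in>D. \<exists>i. partial_deriv i F u \<noteq> 0}"

typedef 'g entire = "{F :: complex^'g::finite \<Rightarrow> complex. holomorphic_several F UNIV}"
  morphisms fun_of Entire
  by (rule exI[of _ "\<lambda>_. 0"])
     (auto simp: holomorphic_several_def intro!: exI[of _ "\<lambda>_. 0"] has_derivative_const)

setup_lifting type_definition_entire

lemma holomorphic_several_const: "holomorphic_several (\<lambda>_. c) U"
  by (auto simp: holomorphic_several_def intro!: exI[of _ "\<lambda>_. 0"] has_derivative_const)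

lemma holomorphic_several_add:
  assumes "holomorphic_several F U" "holomorphic_several G U"
  shows "holomorphic_several (\<lambda>u. F u + G u) U"
  unfolding holomorphic_several_def
proof
  fix u assume "u \<in> U"
  with assms obtain D E where "(F has_derivative D) (at u)" "(G has_derivative E) (at u)"
    "\<And>a h. D (a *s h) = a * D h" "\<And>a h. E (a *s h) = a * E h"
    unfolding holomorphic_several_def by metis
  then show "\<exists>D. ((\<lambda>u. F u + G u) has_derivative D) (at u) \<and> (\<forall>a h. D (a *s h) = a * D h)"
    by (intro exI[of _ "\<lambda>h. D h + E h"] conjI has_derivative_add) (auto simp: algebra_simps)
qed

lemma holomorphic_several_mult:
  assumes "holomorphic_several F U" "holomorphic_several G U"
  shows "holomorphic_several (\<lambda>u. F u * G u) U"
  unfolding holomorphic_several_def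
proof
  fix u assume "u \<in> U"
  with assms obtain D E where "(F has_derivative D) (at u)" "(G has_derivative E) (at u)"
    "\<And>a h. D (a *s h) = a * D h" "\<And>a h. E (a *s h) = a * E h"
    unfolding holomorphic_several_def by metis
  then show "\<exists>D. ((\<lambda>u. F u * G u) has_derivative D) (at u) \<and> (\<forall>a h. D (a *s h) = a * D h)"
    by (intro exI[of _ "\<lambda>h. F u * E h + D h * G u"] conjI has_derivative_mult) (auto simp: algebra_simps)
qed

lift_definition entire_scale :: "complex \<Rightarrow> 'g::finite entire \<Rightarrow> 'g entire" is "\<lambda>a F u. a * F u"
  by (intro holomorphic_several_mult holomorphic_several_const)

lift_definition entire_deriv :: "'g::finite \<Rightarrow> 'g entire \<Rightarrow> 'g entire" is partial_deriv
  by (rule holomorphic_several_partial_deriv)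

instantiation entire :: (finite) comm_ring_1
begin

lift_definition zero_entire :: "'a entire" is "\<lambda>_. 0" by (rule holomorphic_several_const)
lift_definition one_entire :: "'a entire" is "\<lambda>_. 1" by (rule holomorphic_several_const)
lift_definition plus_entire :: "'a entire \<Rightarrow> 'a entire \<Rightarrow> 'a entire" is "\<lambda>F G u. F u + G u"
  by (rule holomorphic_several_add)
lift_definition times_entire :: "'a entire \<Rightarrow> 'a entire \<Rightarrow> 'a entire" is "\<lambda>F G u. F u * G u"
  by (rule holomorphic_several_mult)
lift_definition uminus_entire :: "'a entire \<Rightarrow> 'a entire" is "\<lambda>F u. - F u"
  using holomorphic_several_mult[OF holomorphic_several_const[of "-1"]] by simp
lift_definition minus_entire :: "'a entire \<Rightarrow> 'a entire \<Rightarrow> 'a entire" is "\<lambda>F G u. F u - G u"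
  using holomorphic_several_add[OF _ holomorphic_several_mult[OF holomorphic_several_const[of "-1"]]]
  by fastforce

instance
  by standard (transfer; simp add: fun_eq_iff algebra_simps)+

end

lemma DERIV_axis_slice:
  assumes "holomorphic_several F UNIV"
  shows "((\<lambda>t. F (u + axis i t)) has_field_derivative partial_deriv i F u) (at 0)"
proof -
  obtain D where D: "(F has_derivative D) (at u)" and lin: "\<And>a h. D (a *s h) = a * D h"
    using assms unfolding holomorphic_several_def by (metis UNIV_I)
  have ax: "axis i t = t *s axis i 1" for t :: complex by (rule axis_vscale)
  have "((\<lambda>t. F (u + t *s axis i 1)) has_field_derivative D (axis i 1)) (at 0)"
    by (rule slice_DERIV) (use D lin in auto)
  then have "((\<lambda>t. F (u + axis i t)) has_field_derivative D (axis i 1)) (at 0)"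
    by (subst ax)
  moreover from this have "partial_deriv i F u = D (axis i 1)"
    unfolding partial_deriv_def by (rule DERIV_imp_deriv)
  ultimately show ?thesis by simp
qed

lemma entire_deriv_add: "entire_deriv i (f + g) = entire_deriv i f + entire_deriv i g"
proof (transfer, rule ext)
  fix i :: 'a and f g :: "complex^'a \<Rightarrow> complex" and u
  assume "holomorphic_several f UNIV" "holomorphic_several g UNIV"
  from DERIV_add[OF this[THEN DERIV_axis_slice]]
  show "partial_deriv i (\<lambda>u. f u + g u) u = partial_deriv i f u + partial_deriv i g u"
    unfolding partial_deriv_def[of i "\<lambda>u. f u + g u"] by (rule DERIV_imp_deriv)
qed

lemma entire_deriv_scale: "entire_deriv i (entire_scale a f) = entire_scale a (entire_deriv i f)"
proof (transfer, rule ext)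
  fix i :: 'a and a and f :: "complex^'a \<Rightarrow> complex" and u
  assume "holomorphic_several f UNIV"
  from DERIV_cmult[OF this[THEN DERIV_axis_slice]]
  show "partial_deriv i (\<lambda>u. a * f u) u = a * partial_deriv i f u"
    unfolding partial_deriv_def[of i "\<lambda>u. a * f u"] by (rule DERIV_imp_deriv)
qed

lemma entire_scale_simps [simp]:
  "entire_scale a (f + g) = entire_scale a f + entire_scale a g"
  "entire_scale (a + b) f = entire_scale a f + entire_scale b f"
  "entire_scale a (entire_scale b f) = entire_scale (a * b) f"
  "entire_scale 0 f = 0" "entire_scale 1 f = f" "entire_scale a 0 = 0"
  "entire_scale a f * g = entire_scale a (f * g)" "g * entire_scale a f = entire_scale a (g * f)"
  by (transfer; simp add: fun_eq_iff algebra_simps)+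

lifting_forget entire.lifting


section \<open>Tensor powers of the algebra of entire functions\<close>

text \<open>Finite formal sums of \<open>a \<cdot> f\<^sub>1 \<otimes> \<dots> \<otimes> f\<^sub>m\<close>, represented by lists of pairs
  \<open>(a, [f\<^sub>1, \<dots>, f\<^sub>m])\<close>, modulo the defining relations of the tensor product over the complex
  numbers. The quotient is the direct sum over \<open>m\<close> of the \<open>m\<close>-fold tensor powers; the \<open>m\<close>-fold
  tensor power itself is spanned by the pure tensors of lists of length \<open>m\<close>.\<close>

inductive tensor_eq ::
  "(complex \<times> 'g::finite entire list) list \<Rightarrow> (complex \<times> 'g entire list) list \<Rightarrow> bool" where
  refl: "tensor_eq s s"
| sym: "tensor_eq s t \<Longrightarrow> tensor_eq t s"
| trans: "tensor_eq s t \<Longrightarrow> tensor_eq t r \<Longrightarrow> tensor_eq s r"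
| append: "tensor_eq s s' \<Longrightarrow> tensor_eq t t' \<Longrightarrow> tensor_eq (s @ t) (s' @ t')"
| commute: "tensor_eq (s @ t) (t @ s)"
| zero: "tensor_eq [(0, fs)] []"
| coeff_add: "tensor_eq [(a + b, fs)] [(a, fs), (b, fs)]"
| entry_add: "tensor_eq [(a, fs @ (f + g) # hs)] [(a, fs @ f # hs), (a, fs @ g # hs)]"
| entry_scale: "tensor_eq [(a, fs @ entire_scale b f # hs)] [(a * b, fs @ f # hs)]"

quotient_type 'g tensor = "(complex \<times> 'g::finite entire list) list" / tensor_eq
  by (intro equivpI reflpI sympI transpI) (blast intro: tensor_eq.intros)+

instantiation tensor :: (finite) comm_monoid_add
begin

lift_definition zero_tensor :: "'a tensor" is "[]" .
lift_definition plus_tensor :: "'a tensor \<Rightarrow> 'a tensor \<Rightarrow> 'a tensor" is "(@)"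
  by (rule tensor_eq.append)

instance
  by standard (transfer; simp add: tensor_eq.refl tensor_eq.commute)+

end

lift_definition pure_tensor :: "'g::finite entire list \<Rightarrow> 'g tensor" is "\<lambda>fs. [(1, fs)]" .

lift_definition tensor_scale :: "complex \<Rightarrow> 'g::finite tensor \<Rightarrow> 'g tensor" is
  "\<lambda>c. map (\<lambda>(a, fs). (c * a, fs))"
proof -
  fix c and s t :: "(complex \<times> 'g entire list) list"
  assume "tensor_eq s t"
  then show "tensor_eq (map (\<lambda>(a, fs). (c * a, fs)) s) (map (\<lambda>(a, fs). (c * a, fs)) t)"
    by induction (auto intro: tensor_eq.intros simp: distrib_left mult.assoc[symmetric])
qed

text \<open>\<open>entry_deriv i j\<close> is \<open>\<partial>\<^sub>i\<close> acting on the tensor entry with (zero-based) position \<open>j\<close>.\<close>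

lift_definition entry_deriv :: "'g::finite \<Rightarrow> nat \<Rightarrow> 'g tensor \<Rightarrow> 'g tensor" is
  "\<lambda>i j. map (\<lambda>(a, fs). (a, fs[j := entire_deriv i (fs ! j)]))"
proof -
  fix i :: 'g and j and s t :: "(complex \<times> 'g entire list) list"
  let ?d = "\<lambda>fs. fs[j := entire_deriv i (fs ! j)]"
  have upd: "?d (fs @ f # hs) =
      (if j < length fs then ?d fs @ f # hs
       else if j = length fs then fs @ entire_deriv i f # hs
       else fs @ f # hs[j - Suc (length fs) := entire_deriv i (hs ! (j - Suc (length fs)))])"
    for fs f hs
    by (cases j "length fs" rule: linorder_cases)
       (auto simp: list_update_append nth_append dest!: less_imp_Suc_add)
  assume "tensor_eq s t"
  then show "tensor_eq (map (\<lambda>(a, fs). (a, ?d fs)) s) (map (\<lambda>(a, fs). (a, ?d fs)) t)"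
  proof induction
    case (entry_add a fs f g hs)
    then show ?case
      by (auto simp only: upd list.map prod.case entire_deriv_add split: if_splits intro!: tensor_eq.entry_add)
  next
    case (entry_scale a fs b f hs)
    then show ?case
      by (auto simp only: upd list.map prod.case entire_deriv_scale split: if_splits intro!: tensor_eq.entry_scale)
  qed (auto intro: tensor_eq.intros)
qed

lift_definition symmetrize :: "'g::finite tensor \<Rightarrow> 'g entire" is
  "\<lambda>t. \<Sum>(a, fs)\<leftarrow>t. entire_scale a (prod_list fs)"
proof -
  fix s t :: "(complex \<times> 'g entire list) list"
  assume "tensor_eq s t"
  then show "(\<Sum>(a, fs)\<leftarrow>s. entire_scale a (prod_list fs)) = (\<Sum>(a, fs)\<leftarrow>t. entire_scale a (prod_list fs))"
    by induction (auto simp: algebra_simps)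
qed

definition baker_hirota :: "nat \<Rightarrow> 'g::finite \<Rightarrow> 'g tensor \<Rightarrow> 'g tensor" where
  "baker_hirota m i t =
     (\<Sum>j<m. tensor_scale (exp (2 * of_real pi * \<i> / of_nat m) ^ j) (entry_deriv i j t))"

definition R_function :: "nat \<Rightarrow> 'g::finite list \<Rightarrow> 'g entire \<Rightarrow> complex^'g \<Rightarrow> complex" where
  "R_function m is \<sigma> u =
     (- 1 / (of_nat m * fun_of \<sigma> u ^ m)) *
     fun_of (symmetrize (foldr (baker_hirota m) is (pure_tensor (replicate m \<sigma>)))) u"

lemma sum_list_entire_scale:
  "(\<Sum>(a, fs)\<leftarrow>map (\<lambda>(a, fs). (c * a, fs)) t. entire_scale a (prod_list fs)) =
   entire_scale c (\<Sum>(a, fs)\<leftarrow>t. entire_scale a (prod_list fs))"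
  by (induction t) (auto simp: split_beta)

lemma symmetrize_linear [simp]:
  "symmetrize (pure_tensor fs) = prod_list fs"
  "symmetrize (s + t) = symmetrize s + symmetrize t"
  "symmetrize (tensor_scale c t) = entire_scale c (symmetrize t)"
  by (transfer, simp; fail | transfer, rule sum_list_entire_scale)+

lemma entry_deriv_linear [simp]:
  "entry_deriv i j (pure_tensor fs) = pure_tensor (fs[j := entire_deriv i (fs ! j)])"
  "entry_deriv i j (s + t) = entry_deriv i j s + entry_deriv i j t"
  "entry_deriv i j (tensor_scale c t) = tensor_scale c (entry_deriv i j t)"
  by (transfer; simp add: tensor_eq.refl split_beta o_def)+


section \<open>The curve, its periods and the Abel map\<close>

definition curve_poly :: "(nat \<Rightarrow> complex poly) \<Rightarrow> nat \<Rightarrow> complex \<Rightarrow> complex \<Rightarrow> complex" where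
  "curve_poly q N x y = y ^ N + (\<Sum>j=1..N-1. poly (q j) x * y ^ (N - j)) - poly (q N) x"

definition curve_dx :: "(nat \<Rightarrow> complex poly) \<Rightarrow> nat \<Rightarrow> complex \<Rightarrow> complex \<Rightarrow> complex" where
  "curve_dx q N x y = deriv (\<lambda>w. curve_poly q N w y) x"

definition curve_dy :: "(nat \<Rightarrow> complex poly) \<Rightarrow> nat \<Rightarrow> complex \<Rightarrow> complex \<Rightarrow> complex" where
  "curve_dy q N x y = deriv (\<lambda>w. curve_poly q N x w) y"

definition Ns_curve :: "(nat \<Rightarrow> complex poly) \<Rightarrow> nat \<Rightarrow> nat \<Rightarrow> bool" where
  "Ns_curve q N s \<longleftrightarrow> 2 \<le> N \<and> N < s \<and> coprime N s \<and>
     (\<forall>j\<in>{1..N}. degree (q j) \<le> j * s div N) \<and> degree (q N) = s \<and> lead_coeff (q N) = 1 \<and>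
     (\<forall>x y. curve_poly q N x y = 0 \<longrightarrow> curve_dx q N x y \<noteq> 0 \<or> curve_dy q N x y \<noteq> 0)"

definition affine_curve :: "(nat \<Rightarrow> complex poly) \<Rightarrow> nat \<Rightarrow> (complex \<times> complex) set" where
  "affine_curve q N = {(x, y). curve_poly q N x y = 0}"

text \<open>The compact Riemann surface has exactly one point at infinity, so its underlying space is the
  one-point compactification of the smooth affine curve; \<open>None\<close> is the point at infinity.\<close>

definition riemann_surface :: "(nat \<Rightarrow> complex poly) \<Rightarrow> nat \<Rightarrow> (complex \<times> complex) option topology" where
  "riemann_surface q N = Alexandroff_compactification (top_of_set (affine_curve q N))"

text \<open>Pullback of the differential \<open>A dx / f\<^sub>y\<close> along a curve in the affine part. Where \<open>f\<^sub>y\<close> vanishes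
  the same differential is \<open>- A dy / f\<^sub>x\<close>, because \<open>f\<^sub>x dx + f\<^sub>y dy = 0\<close> on the curve.\<close>

definition pullback_form ::
  "(nat \<Rightarrow> complex poly) \<Rightarrow> nat \<Rightarrow> (complex \<Rightarrow> complex \<Rightarrow> complex) \<Rightarrow> (real \<Rightarrow> complex \<times> complex) \<Rightarrow> real \<Rightarrow> complex" where
  "pullback_form q N A \<gamma> t =
     (let (x, y) = \<gamma> t; (x', y') = vector_derivative \<gamma> (at t) in
      A x y * (if curve_dy q N x y \<noteq> 0 then x' / curve_dy q N x y else - y' / curve_dx q N x y))"

definition affine_loop :: "(nat \<Rightarrow> complex poly) \<Rightarrow> nat \<Rightarrow> (real \<Rightarrow> complex \<times> complex) \<Rightarrow> bool" where
  "affine_loop q N \<gamma> \<longleftrightarrow>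
     valid_path \<gamma> \<and> pathfinish \<gamma> = pathstart \<gamma> \<and> path_image \<gamma> \<subseteq> affine_curve q N"

text \<open>Entry \<open>(k, l)\<close> is the integral of \<open>A\<^sub>k dx / f\<^sub>y\<close> over the loop \<open>\<gamma>\<^sub>l\<close>.\<close>

definition period_matrix ::
  "(nat \<Rightarrow> complex poly) \<Rightarrow> nat \<Rightarrow> ('g \<Rightarrow> complex \<Rightarrow> complex \<Rightarrow> complex) \<Rightarrow>
   ('g \<Rightarrow> real \<Rightarrow> complex \<times> complex) \<Rightarrow> complex^'g^'g::finite" where
  "period_matrix q N A \<gamma> = (\<chi> k l. integral {0..1} (pullback_form q N (A k) (\<gamma> l)))"

text \<open>Singular 1-cycle of a loop. A point \<open>t\<close> of the standard 1-simplex has barycentric coordinates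
  \<open>(t 0, t 1)\<close>.\<close>

definition loop_chain :: "(real \<Rightarrow> complex \<times> complex) \<Rightarrow> (complex \<times> complex) option chain" where
  "loop_chain \<gamma> = frag_of (restrict (\<lambda>t. Some (\<gamma> (t 1))) (standard_simplex 1))"

text \<open>If \<open>w = \<lambda> v\<close> for tangent vectors \<open>v \<noteq> 0\<close>, \<open>w\<close> of the curve at one point, the hermitian
  product below is \<open>\<lambda> |v|\<^sup>2\<close>; so its imaginary part is positive iff \<open>(v, w)\<close> is a positively oriented
  real basis of the tangent line, and zero iff \<open>v\<close>, \<open>w\<close> are linearly dependent over the reals.\<close>

definition tangent_orientation :: "complex \<times> complex \<Rightarrow> complex \<times> complex \<Rightarrow> real" where
  "tangent_orientation v w = sgn (Im (cnj (fst v) * fst w + cnj (snd v) * snd w))"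

definition crossings :: "(real \<Rightarrow> complex \<times> complex) \<Rightarrow> (real \<Rightarrow> complex \<times> complex) \<Rightarrow> (real \<times> real) set" where
  "crossings a b = {(s, t). s \<in> {0..1} \<and> t \<in> {0..1} \<and> a s = b t}"

definition crossing_sign :: "(real \<Rightarrow> complex \<times> complex) \<Rightarrow> (real \<Rightarrow> complex \<times> complex) \<Rightarrow> real \<times> real \<Rightarrow> real" where
  "crossing_sign a b = (\<lambda>(s, t). tangent_orientation (vector_derivative a (at s)) (vector_derivative b (at t)))"

definition transversal :: "(real \<Rightarrow> complex \<times> complex) \<Rightarrow> (real \<Rightarrow> complex \<times> complex) \<Rightarrow> bool" where
  "transversal a b \<longleftrightarrow> finite (crossings a b) \<and>
     (\<forall>(s, t)\<in>crossings a b. 0 < s \<and> s < 1 \<and> 0 < t \<and> t < 1 \<and>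
        a differentiable (at s) \<and> b differentiable (at t) \<and> crossing_sign a b (s, t) \<noteq> 0)"

text \<open>The intersection number of two homology classes is the signed number of crossings of
  transversal representatives; it does not depend on their choice.\<close>

definition intersection_number ::
  "(nat \<Rightarrow> complex poly) \<Rightarrow> nat \<Rightarrow> (real \<Rightarrow> complex \<times> complex) \<Rightarrow> (real \<Rightarrow> complex \<times> complex) \<Rightarrow> int \<Rightarrow> bool" where
  "intersection_number q N a b k \<longleftrightarrow>
     (\<exists>a' b'. affine_loop q N a' \<and> affine_loop q N b' \<and>
        homologous_rel 1 (riemann_surface q N) {} (loop_chain a) (loop_chain a') \<and>
        homologous_rel 1 (riemann_surface q N) {} (loop_chain b) (loop_chain b') \<and>
        transversal a' b' \<and> (\<Sum>p\<in>crossings a' b'. crossing_sign a' b' p) = of_int k)"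

text \<open>Every class in \<open>H\<^sub>1(C, \<int>)\<close> is represented by a piecewise smooth loop avoiding infinity, so the
  classes are given by such loops.\<close>

definition symplectic_basis ::
  "(nat \<Rightarrow> complex poly) \<Rightarrow> nat \<Rightarrow> ('g::finite \<Rightarrow> real \<Rightarrow> complex \<times> complex) \<Rightarrow>
   ('g \<Rightarrow> real \<Rightarrow> complex \<times> complex) \<Rightarrow> bool" where
  "symplectic_basis q N \<alpha> \<beta> \<longleftrightarrow>
     (\<forall>i. affine_loop q N (\<alpha> i) \<and> affine_loop q N (\<beta> i)) \<and>
     (\<forall>z. singular_relcycle 1 (riemann_surface q N) {} z \<longrightarrow>
        (\<exists>!mn :: ('g \<Rightarrow> int) \<times> ('g \<Rightarrow> int). homologous_rel 1 (riemann_surface q N) {} z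
           (\<Sum>i\<in>UNIV. frag_cmul (fst mn i) (loop_chain (\<alpha> i)) + frag_cmul (snd mn i) (loop_chain (\<beta> i))))) \<and>
     (\<forall>i j. intersection_number q N (\<alpha> i) (\<alpha> j) 0 \<and> intersection_number q N (\<beta> i) (\<beta> j) 0 \<and>
        intersection_number q N (\<alpha> i) (\<beta> j) (if i = j then 1 else 0))"

text \<open>\<open>x\<close> and \<open>y\<close> have poles of order \<open>N\<close> and \<open>s\<close> at infinity and \<open>dx / f\<^sub>y\<close> has there a zero of order
  \<open>2g - 2 = N s - N - s - 1\<close> (and no other zero), so \<open>x\<^sup>a y\<^sup>b dx / f\<^sub>y\<close> is holomorphic iff
  \<open>N a + s b \<le> N s - N - s - 1\<close>.\<close>

definition standard_exponents :: "nat \<Rightarrow> nat \<Rightarrow> ('g::finite \<Rightarrow> nat \<times> nat) \<Rightarrow> bool" where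
  "standard_exponents N s h \<longleftrightarrow>
     bij_betw h UNIV {(a, b). N * (a + 1) + s * (b + 1) < N * s}"

definition monomial_fun :: "nat \<times> nat \<Rightarrow> complex \<Rightarrow> complex \<Rightarrow> complex" where
  "monomial_fun h x y = x ^ fst h * y ^ snd h"

text \<open>Evaluation of a polynomial in \<open>y\<close> whose coefficients are polynomials in \<open>x\<close>.\<close>

definition bipoly :: "complex poly poly \<Rightarrow> complex \<Rightarrow> complex \<Rightarrow> complex" where
  "bipoly p x y = poly (poly p [:y:]) x"

text \<open>All values of \<open>\<integral>\<^bsub>\<infinity>\<^esub>\<^bsup>P\<^esup> du\<close> for \<open>P\<close> in the affine part, over paths leaving infinity at parameter
  0; they form a coset of the period lattice. For \<open>P = \<infinity>\<close> only the representative 0 is kept.\<close>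

definition abel_integrals ::
  "(nat \<Rightarrow> complex poly) \<Rightarrow> nat \<Rightarrow> ('g \<Rightarrow> nat \<times> nat) \<Rightarrow> (complex \<times> complex) option \<Rightarrow> (complex^'g::finite) set" where
  "abel_integrals q N h P = (case P of None \<Rightarrow> {0} | Some p \<Rightarrow>
     {v. \<exists>\<gamma> :: real \<Rightarrow> complex \<times> complex.
        (\<forall>\<epsilon>. 0 < \<epsilon> \<and> \<epsilon> \<le> 1 \<longrightarrow> \<gamma> piecewise_C1_differentiable_on {\<epsilon>..1}) \<and>
        \<gamma> ` {0<..1} \<subseteq> affine_curve q N \<and> filterlim \<gamma> at_infinity (at_right 0) \<and> \<gamma> 1 = p \<and>
        ((\<lambda>\<epsilon>. \<chi> k. integral {\<epsilon>..1} (pullback_form q N (monomial_fun (h k)) \<gamma>)) \<longlongrightarrow> v) (at_right 0)})"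


section \<open>Lattice, theta divisor and sigma function\<close>

definition int_vec :: "int^'g \<Rightarrow> complex^'g" where "int_vec m = (\<chi> i. of_int (m $ i))"

definition real_vec :: "real^'g \<Rightarrow> complex^'g" where "real_vec r = (\<chi> i. of_real (r $ i))"

definition period_lattice :: "complex^'g^'g \<Rightarrow> complex^'g^'g \<Rightarrow> (complex^'g::finite) set" where
  "period_lattice \<omega>1 \<omega>2 = {\<omega>1 *v int_vec m + \<omega>2 *v int_vec n | m n. True}"

text \<open>Subsets of the Jacobian are represented by their preimages in \<open>\<complex>\<^sup>g\<close>: \<open>W_preimage\<close> is
  \<open>\<kappa>\<^sup>-\<^sup>1(W\<^sup>[\<^sup>k\<^sup>])\<close> and \<open>Theta_preimage\<close> is \<open>\<kappa>\<^sup>-\<^sup>1(\<Theta>\<^sup>[\<^sup>k\<^sup>])\<close>.\<close>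

definition W_preimage ::
  "(nat \<Rightarrow> complex poly) \<Rightarrow> nat \<Rightarrow> ('g \<Rightarrow> nat \<times> nat) \<Rightarrow> (complex^'g) set \<Rightarrow> nat \<Rightarrow> (complex^'g::finite) set" where
  "W_preimage q N h \<Lambda> k = {(\<Sum>j<k. v j) + l | v l. l \<in> \<Lambda> \<and>
     (\<forall>j<k. \<exists>P\<in>topspace (riemann_surface q N). v j \<in> abel_integrals q N h P)}"

definition Theta_preimage ::
  "(nat \<Rightarrow> complex poly) \<Rightarrow> nat \<Rightarrow> ('g \<Rightarrow> nat \<times> nat) \<Rightarrow> (complex^'g) set \<Rightarrow> nat \<Rightarrow> (complex^'g::finite) set" where
  "Theta_preimage q N h \<Lambda> k = W_preimage q N h \<Lambda> k \<union> uminus ` W_preimage q N h \<Lambda> k"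

definition riemann_theta :: "complex^'g^'g \<Rightarrow> complex^'g \<Rightarrow> complex^'g \<Rightarrow> complex^'g::finite \<Rightarrow> complex" where
  "riemann_theta \<tau> d'' d' z = (\<Sum>\<^sub>\<infinity>m\<in>UNIV. exp (2 * of_real pi * \<i> *
     (1/2 * scalar_product (int_vec m + d'') (\<tau> *v (int_vec m + d'')) +
      scalar_product (int_vec m + d'') (z + d'))))"

text \<open>Riemann's theorem: there is a vector \<open>\<delta>\<close>, unique modulo the lattice and called the Riemann
  constant, such that for all \<open>e\<close> the function \<open>P \<mapsto> \<theta>(\<omega>'\<^sup>-\<^sup>1(e + \<integral>\<^bsub>\<infinity>\<^esub>\<^bsup>P\<^esup> du))\<close> is identically zero or has
  exactly \<open>g\<close> zeros \<open>P\<^sub>i\<close> (with multiplicities), and then \<open>\<Sum>\<^sub>i \<integral>\<^bsub>\<infinity>\<^esub>\<^bsup>P\<^sub>i\<^esup> du \<equiv> \<delta> - e\<close>. For generic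
  \<open>e\<close> the zeros are distinct; these \<open>e\<close> already determine \<open>\<delta>\<close>.\<close>

definition riemann_constant ::
  "(nat \<Rightarrow> complex poly) \<Rightarrow> nat \<Rightarrow> ('g \<Rightarrow> nat \<times> nat) \<Rightarrow> complex^'g^'g \<Rightarrow> complex^'g^'g \<Rightarrow> complex^'g::finite \<Rightarrow> bool" where
  "riemann_constant q N h \<omega>1 \<omega>2 \<delta> \<longleftrightarrow>
     (\<forall>e (P :: 'g \<Rightarrow> (complex \<times> complex) option) v. inj P \<and>
        range P = {p \<in> topspace (riemann_surface q N). \<exists>w\<in>abel_integrals q N h p.
           riemann_theta (matrix_inv \<omega>1 ** \<omega>2) 0 0 (matrix_inv \<omega>1 *v (e + w)) = 0} \<and>
        (\<forall>i. v i \<in> abel_integrals q N h (P i)) \<longrightarrow>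
        (\<Sum>i\<in>UNIV. v i) - (\<delta> - e) \<in> period_lattice \<omega>1 \<omega>2)"

definition sigma_formula ::
  "complex^'g^'g \<Rightarrow> complex^'g^'g \<Rightarrow> complex^'g^'g \<Rightarrow> real^'g \<Rightarrow> real^'g \<Rightarrow> complex \<Rightarrow> complex^'g::finite \<Rightarrow> complex" where
  "sigma_formula \<omega>1 \<omega>2 \<eta>1 \<delta>' \<delta>'' c u =
     c * exp (1/2 * scalar_product u ((\<eta>1 ** matrix_inv \<omega>1) *v u)) *
     riemann_theta (matrix_inv \<omega>1 ** \<omega>2) (real_vec \<delta>'') (real_vec \<delta>') (matrix_inv \<omega>1 *v u)"

definition quasi_periodic ::
  "complex^'g^'g \<Rightarrow> complex^'g^'g \<Rightarrow> complex^'g^'g \<Rightarrow> complex^'g^'g \<Rightarrow> real^'g \<Rightarrow> real^'g \<Rightarrow>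
   (complex^'g::finite \<Rightarrow> complex) \<Rightarrow> bool" where
  "quasi_periodic \<omega>1 \<omega>2 \<eta>1 \<eta>2 \<delta>' \<delta>'' F \<longleftrightarrow>
     (\<forall>m n u. let l' = int_vec m; l'' = int_vec n; l = \<omega>1 *v l' + \<omega>2 *v l'';
          L = scalar_product (u + (1/2) *s l) (\<eta>1 *v l' + \<eta>2 *v l'');
          \<rho> = exp (2 * of_real pi * \<i> * (scalar_product l' (real_vec \<delta>'')
                - scalar_product l'' (real_vec \<delta>') + 1/2 * scalar_product l' l''))
        in F (u + l) = \<rho> * exp L * F u)"

text \<open>The values on the polar set \<open>D\<close> carry no meaning, so periodicity is required off \<open>D\<close>.\<close>

definition standard_abelian :: "(complex^'g) set \<Rightarrow> (complex^'g) set \<Rightarrow> (complex^'g::finite \<Rightarrow> complex) \<Rightarrow> bool" where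
  "standard_abelian \<Lambda> D M \<longleftrightarrow> meromorphic_several M \<and> poles_only_along M D \<and>
     (\<forall>l\<in>\<Lambda>. \<forall>u. u \<notin> D \<longrightarrow> M (u + l) = M u)"

end

theory Submission
  imports Defs
begin

text \<open>A translation by a period multiplies the sigma function by a nowhere vanishing factor \<open>E\<close> with
  \<open>\<partial>\<^sub>i E = \<mu>\<^sub>i E\<close> for a constant \<open>\<mu>\<^sub>i\<close>. Pulling \<open>E\<close> out of every tensor entry therefore replaces
  \<open>\<H>\<^sub>i\<close> by \<open>\<H>\<^sub>i + \<mu>\<^sub>i (1 + \<zeta> + \<dots> + \<zeta>\<^sup>m\<^sup>-\<^sup>1) = \<H>\<^sub>i\<close>, so the numerator of the \<open>\<R>\<close>-function and the
  denominator \<open>\<sigma>\<^sup>m\<close> are both multiplied by \<open>E\<^sup>m\<close>.\<close>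

section \<open>Holomorphic functions of several variables\<close>

lemma holomorphic_several_subset:
  "holomorphic_several F U \<Longrightarrow> V \<subseteq> U \<Longrightarrow> holomorphic_several F V"
  unfolding holomorphic_several_def by blast

lemma holomorphic_several_power:
  assumes "holomorphic_several F U"
  shows "holomorphic_several (\<lambda>u. F u ^ n) U"
  by (induction n) (auto intro: holomorphic_several_const holomorphic_several_mult[OF assms])

lemma holomorphic_several_inverse:
  assumes "holomorphic_several F U" "\<And>u. u \<in> U \<Longrightarrow> F u \<noteq> 0"
  shows "holomorphic_several (\<lambda>u. inverse (F u)) U"
  unfolding holomorphic_several_def
proof
  fix u assume u: "u \<in> U"
  with assms(1) obtain D where "(F has_derivative D) (at u)" "\<And>a h. D (a *s h) = a * D h"
    unfolding holomorphic_several_def by metis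
  with assms(2)[OF u] show "\<exists>D. ((\<lambda>u. inverse (F u)) has_derivative D) (at u) \<and> (\<forall>a h. D (a *s h) = a * D h)"
    by (intro exI[of _ "\<lambda>h. - (inverse (F u) * D h * inverse (F u))"] conjI Deriv.has_derivative_inverse) auto
qed

lemma holomorphic_several_divide:
  assumes "holomorphic_several F U" "holomorphic_several G U" "\<And>u. u \<in> U \<Longrightarrow> G u \<noteq> 0"
  shows "holomorphic_several (\<lambda>u. F u / G u) U"
  using holomorphic_several_mult[OF assms(1) holomorphic_several_inverse[OF assms(2,3)]]
  by (simp add: divide_inverse)

lemma holomorphic_several_continuous_on:
  fixes F :: "complex^'g::finite \<Rightarrow> complex"
  assumes "holomorphic_several F U"
  shows "continuous_on U F"
  using assms unfolding holomorphic_several_def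
  by (meson continuous_at_imp_continuous_on has_derivative_continuous)

text \<open>If \<open>F\<close> were identically zero, \<open>D\<close> would be the whole space and
  all gradients would vanish, so the closure required to contain \<open>D\<close> would be empty.
  This provides the nonzero denominator for meromorphy.\<close>

lemma vanishes_exactly_to_order_one_not_zero:
  assumes "vanishes_exactly_to_order_one F D"
  shows "\<exists>u. F u \<noteq> 0"
proof (rule ccontr)
  assume "\<not> ?thesis"
  then have F: "F = (\<lambda>_. 0)" by auto
  then have "partial_deriv i F u = 0" for i u
    by (simp add: partial_deriv_def)
  with assms F show False
    by (auto simp: vanishes_exactly_to_order_one_def)
qed

section \<open>Evaluation of entire functions\<close>

lemma holomorphic_fun_of: "holomorphic_several (fun_of f) UNIV"
  using fun_of by blast

lemma fun_of_simps [simp]: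
  "fun_of 0 u = 0" "fun_of 1 u = 1"
  "fun_of (f + g) u = fun_of f u + fun_of g u"
  "fun_of (f * g) u = fun_of f u * fun_of g u"
  "fun_of (entire_scale a f) u = a * fun_of f u"
  by (simp_all add: zero_entire.rep_eq one_entire.rep_eq plus_entire.rep_eq times_entire.rep_eq
      entire_scale.rep_eq)

lemma fun_of_sum: "fun_of (sum f A) u = (\<Sum>a\<in>A. fun_of (f a) u)"
  by (induction A rule: infinite_finite_induct) auto

section \<open>Linearity of the Baker--Hirota operators\<close>

lemma tensor_scale_add: "tensor_scale c (s + t) = tensor_scale c s + tensor_scale c t"
  by transfer (simp add: tensor_eq.refl)

lemma tensor_scale_scale: "tensor_scale c (tensor_scale d t) = tensor_scale (c * d) t"
  by transfer (simp add: tensor_eq.refl case_prod_unfold o_def mult.assoc)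

lemma tensor_scale_zero: "tensor_scale c 0 = 0"
  by transfer (simp add: tensor_eq.refl)

lemma tensor_scale_sum: "tensor_scale c (sum f A) = (\<Sum>a\<in>A. tensor_scale c (f a))"
  by (induction A rule: infinite_finite_induct) (auto simp: tensor_scale_add tensor_scale_zero)

lemma entry_deriv_zero: "entry_deriv i j 0 = 0"
  by transfer (simp add: tensor_eq.refl)

text \<open>At an actual position the updated list has the shape of the relation
  \<open>entry_add\<close>. Past the end an update changes nothing, and the right side would be
  twice the left.\<close>

lemma pure_tensor_update_add:
  assumes "j < length fs"
  shows "pure_tensor (fs[j := f + g]) = pure_tensor (fs[j := f]) + pure_tensor (fs[j := g])"
  unfolding upd_conv_take_nth_drop[OF assms]
  by transfer (use tensor_eq.entry_add in force)

lemma pure_tensor_update_scale: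
  assumes "j < length fs"
  shows "pure_tensor (fs[j := entire_scale a f]) = tensor_scale a (pure_tensor (fs[j := f]))"
  unfolding upd_conv_take_nth_drop[OF assms]
  by transfer (use tensor_eq.entry_scale[of 1] in simp)

lemma symmetrize_zero: "symmetrize 0 = 0"
  by transfer simp

lemma symmetrize_sum: "symmetrize (sum f A) = (\<Sum>a\<in>A. symmetrize (f a))"
  by (induction A rule: infinite_finite_induct) (auto simp: symmetrize_zero)

lemma baker_hirota_linear:
  "baker_hirota m i (s + t) = baker_hirota m i s + baker_hirota m i t"
  "baker_hirota m i (tensor_scale c t) = tensor_scale c (baker_hirota m i t)"
  "baker_hirota m i 0 = 0"
  by (simp_all add: baker_hirota_def tensor_scale_add tensor_scale_scale tensor_scale_zero
      tensor_scale_sum entry_deriv_zero sum.distrib mult.commute)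

lemma foldr_baker_hirota_linear:
  "foldr (baker_hirota m) is (s + t) = foldr (baker_hirota m) is s + foldr (baker_hirota m) is t"
  "foldr (baker_hirota m) is (tensor_scale c t) = tensor_scale c (foldr (baker_hirota m) is t)"
  "foldr (baker_hirota m) is 0 = 0"
  by (induction "is") (auto simp: baker_hirota_linear)

lemma foldr_baker_hirota_sum:
  "foldr (baker_hirota m) is (sum f A) = (\<Sum>a\<in>A. foldr (baker_hirota m) is (f a))"
  by (induction A rule: infinite_finite_induct) (auto simp: foldr_baker_hirota_linear)

section \<open>Numerators of the R-functions\<close>

text \<open>The entries are left arbitrary because induction on the operators meets lists in which
  some copies of \<sigma> have already been differentiated.\<close>

definition hirota_product :: "nat \<Rightarrow> 'g::finite list \<Rightarrow> 'g entire list \<Rightarrow> 'g entire" where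
  "hirota_product m is fs = symmetrize (foldr (baker_hirota m) is (pure_tensor fs))"

lemma hirota_product_Nil: "hirota_product m [] fs = prod_list fs"
  by (simp add: hirota_product_def)

text \<open>\<open>foldr\<close> applies the last index first, directly to a pure tensor; this turns
  it into a combination of pure tensors with one differentiated entry each, which gives a recursion
  on entry lists.\<close>

lemma hirota_product_snoc:
  "hirota_product m (is @ [i]) fs =
     (\<Sum>j<m. entire_scale (exp (2 * of_real pi * \<i> / of_nat m) ^ j)
        (hirota_product m is (fs[j := entire_deriv i (fs ! j)])))"
  by (simp add: hirota_product_def baker_hirota_def foldr_baker_hirota_sum foldr_baker_hirota_linear
      symmetrize_sum)

text \<open>Multilinearity in the entries. It splits off the term that comes from differentiating
  the translation factor, with the entry list unchanged.\<close>

lemma hirota_product_update_add_scale: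
  assumes "j < length fs"
  shows "hirota_product m is (fs[j := entire_scale a (fs ! j) + g]) =
     entire_scale a (hirota_product m is fs) + hirota_product m is (fs[j := g])"
  using assms
  by (simp add: hirota_product_def pure_tensor_update_add pure_tensor_update_scale
      foldr_baker_hirota_linear)

lemma sum_powers_root_of_unity:
  assumes "2 \<le> m"
  shows "(\<Sum>j<m. exp (2 * of_real pi * \<i> / of_nat m) ^ j) = (0 :: complex)"
proof -
  let ?z = "exp (2 * of_real pi * \<i> / of_nat m) :: complex"
  have "?z ^ m = 1"
    using assms by (simp flip: exp_of_nat_mult)
  \<comment> \<open>The root equals 1 only if \<open>m\<close> divides 1.\<close>
  moreover have "?z \<noteq> 1"
    using complex_root_unity_eq_1[of m 1] assms by simp
  ultimately show ?thesis
    by (simp add: geometric_sum)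
qed

text \<open>The product rule. \<open>F\<close> and \<open>G\<close> may differ because the
  derivative of an entry translates not to \<open>E\<close> times itself but to \<open>E\<close>
  times a shifted derivative.\<close>

lemma partial_deriv_translate:
  assumes F: "holomorphic_several F UNIV" and G: "holomorphic_several G UNIV"
    and trans: "\<And>u. G (u + l) = E u * F u"
    and E: "\<And>u. ((\<lambda>t. E (u + axis i t)) has_field_derivative a * E u) (at 0)"
  shows "partial_deriv i G (u + l) = E u * (a * F u + partial_deriv i F u)"
proof -
  have "((\<lambda>t. E (u + axis i t) * F (u + axis i t)) has_field_derivative
      E u * (a * F u + partial_deriv i F u)) (at 0)"
    using DERIV_mult[OF E[of u] DERIV_axis_slice[OF F, of u i]]
    \<comment> \<open>The instance at 0 makes \<open>axis i 0\<close> vanish, so both factors are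
      evaluated at \<open>u\<close>.\<close>
    by (simp add: axis_vscale[of i 0] algebra_simps)
  moreover have "G (u + l + axis i t) = E (u + axis i t) * F (u + axis i t)" for t
    using trans[of "u + axis i t"] by (simp add: ac_simps)
  ultimately show ?thesis
    unfolding partial_deriv_def[of i G] by (simp add: DERIV_imp_deriv)
qed

text \<open>Two lists are needed: differentiating \<open>gs\<close> at one position matches
  replacing f in \<open>fs\<close> by \<open>\<mu> i\<close> times f plus its derivative, so
  equality of the lists would not survive the induction. Each of the \<open>m\<close> entries
  contributes one factor \<open>E\<close>.\<close>

lemma hirota_product_translate:
  assumes m: "2 \<le> m"
    and E: "\<And>i u. ((\<lambda>t. E (u + axis i t)) has_field_derivative \<mu> i * E u) (at 0)"
    and trans: "list_all2 (\<lambda>g f. \<forall>u. fun_of g (u + l) = E u * fun_of f u) gs fs"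
    and len: "length fs = m"
  shows "fun_of (hirota_product m is gs) (u + l) = E u ^ m * fun_of (hirota_product m is fs) u"
  using trans len
proof (induction "is" arbitrary: fs gs rule: rev_induct)
  case Nil
  from Nil(1) have "fun_of (prod_list gs) (u + l) = E u ^ length fs * fun_of (prod_list fs) u"
    by (induction rule: list_all2_induct) auto
  with Nil(2) show ?case by (simp add: hirota_product_Nil)
next
  case (snoc i "is")
  let ?z = "exp (2 * of_real pi * \<i> / of_nat m) :: complex"
  have "fun_of (hirota_product m is (gs[j := entire_deriv i (gs ! j)])) (u + l) =
      E u ^ m * (\<mu> i * fun_of (hirota_product m is fs) u +
        fun_of (hirota_product m is (fs[j := entire_deriv i (fs ! j)])) u)" if j: "j < m" for j
  proof -
    have "fun_of (entire_deriv i (gs ! j)) (v + l) =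
        E v * fun_of (entire_scale (\<mu> i) (fs ! j) + entire_deriv i (fs ! j)) v" for v
      unfolding fun_of_simps entire_deriv.rep_eq
      by (rule partial_deriv_translate[OF holomorphic_fun_of holomorphic_fun_of _ E])
        (use snoc.prems j in \<open>auto simp: list_all2_conv_all_nth\<close>)
    \<comment> \<open>The updated lists are again related by the same \<open>E\<close>, so the
      induction hypothesis applies to them.\<close>
    then have "list_all2 (\<lambda>g f. \<forall>u. fun_of g (u + l) = E u * fun_of f u)
        (gs[j := entire_deriv i (gs ! j)])
        (fs[j := entire_scale (\<mu> i) (fs ! j) + entire_deriv i (fs ! j)])"
      by (intro list_all2_update_cong snoc.prems) blast
    from snoc.IH[OF this] snoc.prems(2) j show ?thesis
      by (simp add: hirota_product_update_add_scale)
  qed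
  then have "fun_of (hirota_product m (is @ [i]) gs) (u + l) =
      (\<Sum>j<m. ?z ^ j * (E u ^ m * (\<mu> i * fun_of (hirota_product m is fs) u +
        fun_of (hirota_product m is (fs[j := entire_deriv i (fs ! j)])) u)))"
    by (simp add: hirota_product_snoc fun_of_sum)
  \<comment> \<open>The \<open>\<mu> i\<close> term is independent of \<open>j\<close>, so its total
    coefficient is the sum of the powers of the root of unity; the rest is the recursion for
    \<open>fs\<close>.\<close>
  also have "\<dots> = (\<Sum>j<m. ?z ^ j) * (E u ^ m * \<mu> i * fun_of (hirota_product m is fs) u) +
      E u ^ m * fun_of (hirota_product m (is @ [i]) fs) u"
    by (simp add: hirota_product_snoc fun_of_sum sum_distrib_left sum_distrib_right
        sum.distrib algebra_simps)
  finally show ?case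
    by (simp add: sum_powers_root_of_unity[OF m])
qed

section \<open>R-functions are Abelian\<close>

lemma R_function_eq:
  "R_function m is \<sigma> u =
     - fun_of (hirota_product m is (replicate m \<sigma>)) u / (of_nat m * fun_of \<sigma> u ^ m)"
  by (simp add: R_function_def hirota_product_def)

lemma R_function_periodic:
  assumes m: "2 \<le> m"
    and E: "\<And>i u. ((\<lambda>t. E (u + axis i t)) has_field_derivative \<mu> i * E u) (at 0)"
    and nz: "E u \<noteq> 0"
    and trans: "\<And>u. fun_of \<sigma> (u + l) = E u * fun_of \<sigma> u"
  shows "R_function m is \<sigma> (u + l) = R_function m is \<sigma> u"
proof -
  have "list_all2 (\<lambda>g f. \<forall>u. fun_of g (u + l) = E u * fun_of f u) (replicate m \<sigma>) (replicate m \<sigma>)"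
    by (simp add: list_all2_conv_all_nth trans)
  from hirota_product_translate[OF m E this] nz show ?thesis
    by (simp add: R_function_eq trans power_mult_distrib)
qed

lemma R_function_holomorphic_parts:
  "holomorphic_several (\<lambda>u. - fun_of (hirota_product m is (replicate m \<sigma>)) u) UNIV"
  "holomorphic_several (\<lambda>u. of_nat m * fun_of \<sigma> u ^ m) UNIV"
  using holomorphic_several_mult[OF holomorphic_several_const[of "-1"] holomorphic_fun_of]
  by (auto intro!: holomorphic_several_mult holomorphic_several_const holomorphic_several_power
      holomorphic_fun_of)

lemma meromorphic_R_function:
  assumes "0 < m" "\<exists>u. fun_of \<sigma> u \<noteq> 0"
  shows "meromorphic_several (R_function m is \<sigma>)"
  unfolding meromorphic_several_def
proof (intro allI exI conjI)
  \<comment> \<open>One global quotient of entire functions serves at every point.\<close>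
  show "\<exists>u\<in>UNIV. of_nat m * fun_of \<sigma> u ^ m \<noteq> 0"
    using assms by auto
  show "\<forall>u\<in>UNIV. of_nat m * fun_of \<sigma> u ^ m \<noteq> 0 \<longrightarrow> R_function m is \<sigma> u =
      - fun_of (hirota_product m is (replicate m \<sigma>)) u / (of_nat m * fun_of \<sigma> u ^ m)"
    by (simp add: R_function_eq)
qed (auto intro: R_function_holomorphic_parts)

lemma poles_only_along_R_function:
  assumes "0 < m" "{u. fun_of \<sigma> u = 0} \<subseteq> D"
  shows "poles_only_along (R_function m is \<sigma>) D"
  unfolding poles_only_along_def
proof (intro allI impI exI conjI)
  \<comment> \<open>The same neighbourhood works for all points off \<open>D\<close>.\<close>
  let ?U = "{u. fun_of \<sigma> u \<noteq> 0}"
  show "open ?U"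
    by (intro open_Collect_neq holomorphic_several_continuous_on holomorphic_fun_of continuous_on_const)
  show "p \<in> ?U" if "p \<notin> D" for p
    using that assms(2) by auto
  show "holomorphic_several (R_function m is \<sigma>) ?U"
    unfolding R_function_eq[abs_def]
    by (intro holomorphic_several_divide holomorphic_several_subset[OF R_function_holomorphic_parts(1)]
        holomorphic_several_subset[OF R_function_holomorphic_parts(2)]) (use assms(1) in auto)
qed

text \<open>The exponent L is affine in \<open>u\<close>, so the logarithmic derivatives of the
  factor are constants: \<open>\<mu> i\<close> is the \<open>i\<close>-th entry of the quasi-period
  \<open>v\<close>. The remaining factor \<open>\<rho>\<close> depends only on the period.\<close>

lemma quasi_periodic_factor:
  assumes "quasi_periodic \<omega>1 \<omega>2 \<eta>1 \<eta>2 \<delta>' \<delta>'' F" "l \<in> period_lattice \<omega>1 \<omega>2"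
  obtains E \<mu> where "\<And>u. F (u + l) = E u * F u" "\<And>u. E u \<noteq> 0"
    "\<And>i u. ((\<lambda>t. E (u + axis i t)) has_field_derivative \<mu> i * E u) (at 0)"
proof -
  obtain m n where l: "l = \<omega>1 *v int_vec m + \<omega>2 *v int_vec n"
    using assms(2) by (auto simp: period_lattice_def)
  define v where "v = \<eta>1 *v int_vec m + \<eta>2 *v int_vec n"
  obtain \<rho> where \<rho>: "\<rho> \<noteq> 0" "\<And>u. F (u + l) = \<rho> * exp (scalar_product (u + (1/2) *s l) v) * F u"
    using assms(1) unfolding quasi_periodic_def Let_def l v_def by (metis exp_not_eq_zero)
  have lin: "scalar_product (u + axis i t + (1/2) *s l) v =
      scalar_product (u + (1/2) *s l) v + t * v $ i" for u i t
  proof -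
    have "(\<Sum>k\<in>UNIV. axis i t $ k * v $ k) = t * v $ i"
      by (simp add: axis_def if_distrib[of "\<lambda>x. x * _"] cong: if_cong)
    then show ?thesis
      by (simp add: scalar_product_def sum.distrib distrib_right)
  qed
  show thesis
  proof
    show "F (u + l) = (\<rho> * exp (scalar_product (u + (1/2) *s l) v)) * F u" for u
      by (rule \<rho>)
    show "\<rho> * exp (scalar_product (u + (1/2) *s l) v) \<noteq> 0" for u
      using \<rho>(1) by simp
    show "((\<lambda>t. \<rho> * exp (scalar_product (u + axis i t + (1/2) *s l) v)) has_field_derivative
        v $ i * (\<rho> * exp (scalar_product (u + (1/2) *s l) v))) (at 0)" for i u
      unfolding lin by (auto intro!: derivative_eq_intros)
  qed
qed

theorem theorem6p3:
  fixes N s m :: nat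
    and q :: "nat \<Rightarrow> complex poly"
    and h :: "'g::{finite,linorder} \<Rightarrow> nat \<times> nat"
    and \<alpha> \<beta> :: "'g::{finite,linorder} \<Rightarrow> real \<Rightarrow> complex \<times> complex"
    and r :: "'g::{finite,linorder} \<Rightarrow> complex poly poly"
    and \<omega>1 \<omega>2 \<eta>1 \<eta>2 :: "complex^('g::{finite,linorder})^('g::{finite,linorder})"
    and \<Lambda> \<Theta> :: "(complex^('g::{finite,linorder})) set"
    and \<delta>' \<delta>'' :: "real^('g::{finite,linorder})"
    and c :: complex
    and \<sigma> :: "'g::{finite,linorder} entire"
    and "is" :: "'g::{finite,linorder} list"
  assumes curve: "Ns_curve q N s"
    and genus: "2 * CARD('g) = (N - 1) * (s - 1)"
    and du: "standard_exponents N s h"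
    and basis: "symplectic_basis q N \<alpha> \<beta>"
    and periods: "\<omega>1 = period_matrix q N (\<lambda>k. monomial_fun (h k)) \<alpha>"
      "\<omega>2 = period_matrix q N (\<lambda>k. monomial_fun (h k)) \<beta>"
      "\<eta>1 = period_matrix q N (\<lambda>k. bipoly (r k)) \<alpha>"
      "\<eta>2 = period_matrix q N (\<lambda>k. bipoly (r k)) \<beta>"
    and legendre: "transpose (\<eta>1 ** matrix_inv \<omega>1) = \<eta>1 ** matrix_inv \<omega>1"
      "\<eta>2 = \<eta>1 ** matrix_inv \<omega>1 ** \<omega>2 - mat (2 * of_real pi * \<i>) ** transpose (matrix_inv \<omega>1)"
    and lattice: "\<Lambda> = period_lattice \<omega>1 \<omega>2"
    and theta_divisor: "\<Theta> = Theta_preimage q N h \<Lambda> (CARD('g) - 1)"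
    and riemann_const: "riemann_constant q N h \<omega>1 \<omega>2 (\<omega>1 *v real_vec \<delta>' + \<omega>2 *v real_vec \<delta>'')"
    and c: "c \<noteq> 0"
    and sigma: "fun_of \<sigma> = sigma_formula \<omega>1 \<omega>2 \<eta>1 \<delta>' \<delta>'' c"
    and sigma_zeros: "vanishes_exactly_to_order_one (fun_of \<sigma>) \<Theta>"
    and sigma_quasi_periodic: "quasi_periodic \<omega>1 \<omega>2 \<eta>1 \<eta>2 \<delta>' \<delta>'' (fun_of \<sigma>)"
    and m: "2 \<le> m"
    and "is": "length is \<ge> 1" "sorted is"
  shows "standard_abelian \<Lambda> \<Theta> (R_function m is \<sigma>)"
proof -
  have zeros: "{u. fun_of \<sigma> u = 0} = \<Theta>"
    using sigma_zeros by (simp add: vanishes_exactly_to_order_one_def)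
  have m0: "0 < m" using m by simp
  \<comment> \<open>This holds on \<Theta> too: \<sigma> vanishes at \<open>u\<close> and
    \<open>u + l\<close> together, and division by zero gives 0 at both.\<close>
  have "R_function m is \<sigma> (u + l) = R_function m is \<sigma> u" if l: "l \<in> \<Lambda>" for l u
  proof -
    obtain E \<mu> where trans: "\<And>u. fun_of \<sigma> (u + l) = E u * fun_of \<sigma> u"
      and nz: "\<And>u. E u \<noteq> 0"
      and E: "\<And>i u. ((\<lambda>t. E (u + axis i t)) has_field_derivative \<mu> i * E u) (at 0)"
      using quasi_periodic_factor[OF sigma_quasi_periodic l[unfolded lattice]] by metis
    show ?thesis
      by (rule R_function_periodic[OF m E nz trans])
  qed
  then show ?thesis
    unfolding standard_abelian_def
    using meromorphic_R_function[OF m0 vanishes_exactly_to_order_one_not_zero[OF sigma_zeros]]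
      poles_only_along_R_function[OF m0 equalityD1[OF zeros]] by blast
qed

end
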